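(* Let $R$ be a commutative ring with unity that has at least one nontrivial idempotent. Then: (i) If $|U(R)|=1$, then $\mathrm{Cl}(R)$ is a complete graph. (ii) If $|U(R)|\ge 2$, then two distinct vertices $(e,u)$ and $(f,v)$ of $\mathrm{Cl}(R)$ are mutually maximally distant in $\mathrm{Cl}(R)$ if and only if either $e=f=0$, or $e\neq 0$, $f\neq 0$, $ef\neq 0$ and $uv\neq 1$.
   Context: All rings are commutative with unity. $U(R)$ is the set of units, $\mathrm{Id}(R)$ the set of idempotents; a nontrivial idempotent is one different from $0,1$. The clean graph $\mathrm{Cl}(R)$ is the simple undirected graph with vertex set $\{(e,u): e\in \mathrm{Id}(R),\ u\in U(R)\}$ in which two distinct vertices $(e,u),(f,v)$ are adjacent iff $ef=0$ or $uv=1$. For a connected graph, $d$ is the graph distance and $N(x)$ the neighbourhood of $x$. A vertex $x$ is maximally distant from $y$ if $d(y,w)\le d(x,y)$ for every $w\in N(x)$; $x,y$ are mutually maximally distant if each is maximally distant from the other. *)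

theory Defs
  imports "HOL-Algebra.Ring" "Graph_Theory.Graph_Theory"
begin

definition idempotents :: "('a, 'm) ring_scheme \<Rightarrow> 'a set" where
  "idempotents R = {e \<in> carrier R. e \<otimes>\<^bsub>R\<^esub> e = e}"

text \<open>An undirected graph is encoded, as usual in \<^theory>\<open>Graph_Theory.Digraph\<close>, as a digraph
  with symmetric arc set; no finiteness is assumed.\<close>

definition clean_graph ::
    "('a, 'm) ring_scheme \<Rightarrow> ('a \<times> 'a, ('a \<times> 'a) \<times> ('a \<times> 'a)) pre_digraph" where
  "clean_graph R = with_proj
     \<lparr> pverts = idempotents R \<times> Units R,
       parcs = {((e, u), (f, v)) | e u f v.
         (e, u) \<in> idempotents R \<times> Units R \<and> (f, v) \<in> idempotents R \<times> Units R \<and>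
         (e, u) \<noteq> (f, v) \<and> (e \<otimes>\<^bsub>R\<^esub> f = \<zero>\<^bsub>R\<^esub> \<or> u \<otimes>\<^bsub>R\<^esub> v = \<one>\<^bsub>R\<^esub>)} \<rparr>"

lemma clean_graph_simple:
  assumes "cring R"
  shows "loopfree_digraph (clean_graph R)" "nomulti_digraph (clean_graph R)"
    "sym_digraph (clean_graph R)"
proof -
  interpret cring R by fact
  show "loopfree_digraph (clean_graph R)"
    by unfold_locales (auto simp: clean_graph_def)
  show "nomulti_digraph (clean_graph R)"
    by unfold_locales (auto simp: clean_graph_def arc_to_ends_def)
  show "sym_digraph (clean_graph R)"
    by unfold_locales
      (auto simp: clean_graph_def symmetric_def sym_def idempotents_def m_comm Units_closed)
qed

text \<open>The library predicate \<^const>\<open>complete_digraph\<close> without its finiteness requirement: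
  the set of idempotents may be infinite even if there is only one unit.\<close>

definition complete_graph :: "('a, 'b) pre_digraph \<Rightarrow> bool" where
  "complete_graph G \<longleftrightarrow> arcs_ends G = {(x, y). x \<in> verts G \<and> y \<in> verts G \<and> x \<noteq> y}"

definition neighbourhood :: "('a, 'b) pre_digraph \<Rightarrow> 'a \<Rightarrow> 'a set" where
  "neighbourhood G x = {w. x \<rightarrow>\<^bsub>G\<^esub> w}"

text \<open>Least number of arcs of a walk, that is, least cost with all arcs of cost \<open>1\<close>.\<close>

definition graph_dist :: "('a, 'b) pre_digraph \<Rightarrow> 'a \<Rightarrow> 'a \<Rightarrow> ereal" where
  "graph_dist G x y = wf_digraph.\<mu> G (\<lambda>_. 1) x y"

definition maximally_distant_from :: "('a, 'b) pre_digraph \<Rightarrow> 'a \<Rightarrow> 'a \<Rightarrow> bool" where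
  "maximally_distant_from G x y \<longleftrightarrow>
     (\<forall>w \<in> neighbourhood G x. graph_dist G y w \<le> graph_dist G x y)"

definition mutually_maximally_distant :: "('a, 'b) pre_digraph \<Rightarrow> 'a \<Rightarrow> 'a \<Rightarrow> bool" where
  "mutually_maximally_distant G x y \<longleftrightarrow>
     maximally_distant_from G x y \<and> maximally_distant_from G y x"

end

theory Submission
  imports Defs
begin

text \<open>Every vertex with idempotent part \<open>0\<close> is adjacent to all others, so the clean graph has
  diameter at most \<open>2\<close>. Hence non-adjacent vertices are always mutually maximally distant, while
  adjacent ones are so exactly when they have the same closed neighbourhood. Once there
  are two units, for every unit \<open>v\<close> there is a unit different from both \<open>v\<close> and its
  inverse (if \<open>v\<close> is not self-inverse, take \<open>1\<close>); this, together with a nontrivial idempotent,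
  separates the closed neighbourhoods of adjacent vertices that do not both have idempotent
  part \<open>0\<close>.\<close>

section \<open>Distances 0, 1 and 2 in digraphs\<close>

lemma (in wf_digraph) graph_dist_self:
  assumes "x \<in> verts G"
  shows "graph_dist G x x = 0"
  unfolding graph_dist_def
proof (rule antisym)
  have "awalk x [] x" using assms by (simp add: awalk_Nil_iff)
  then show "\<mu> (\<lambda>_. 1) x x \<le> 0"
    unfolding \<mu>_def by (auto intro!: INF_lower2[of "[]"])
  \<comment> \<open>With all weights equal to 1, the cost of a walk is its length.\<close>
  show "0 \<le> \<mu> (\<lambda>_. 1) x x"
    unfolding \<mu>_def by (auto intro!: INF_greatest simp: awalk_cost_def sum_list_triv)
qed

lemma (in wf_digraph) graph_dist_le_1:
  assumes "x \<rightarrow>\<^bsub>G\<^esub> y"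
  shows "graph_dist G x y \<le> 1"
proof -
  obtain a where "a \<in> arcs G" "tail G a = x" "head G a = y"
    using assms by (auto simp: arcs_ends_def arc_to_ends_def)
  then have "awalk x [a] y" by (auto simp: awalk_Cons_iff awalk_Nil_iff)
  then show ?thesis
    unfolding graph_dist_def \<mu>_def by (auto intro!: INF_lower2[of "[a]"] simp: one_ereal_def)
qed

lemma (in wf_digraph) graph_dist_le_2:
  assumes "x \<rightarrow>\<^bsub>G\<^esub> z" and "z \<rightarrow>\<^bsub>G\<^esub> y"
  shows "graph_dist G x y \<le> 2"
proof -
  obtain a where "a \<in> arcs G" "tail G a = x" "head G a = z"
    using assms(1) by (auto simp: arcs_ends_def arc_to_ends_def)
  moreover obtain b where "b \<in> arcs G" "tail G b = z" "head G b = y"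
    using assms(2) by (auto simp: arcs_ends_def arc_to_ends_def)
  ultimately have "awalk x [a, b] y" by (auto simp: awalk_Cons_iff awalk_Nil_iff)
  then show ?thesis
    unfolding graph_dist_def \<mu>_def by (auto intro!: INF_lower2[of "[a, b]"])
qed

lemma (in wf_digraph) graph_dist_ge_1:
  assumes "x \<noteq> y"
  shows "1 \<le> graph_dist G x y"
  unfolding graph_dist_def \<mu>_def
proof (rule INF_greatest)
  fix p assume "p \<in> {p. awalk x p y}"
  then have "length p \<ge> 1" using assms by (cases p) (auto simp: awalk_Nil_iff)
  then show "1 \<le> ereal (awalk_cost (\<lambda>_. 1) p)"
    by (simp add: awalk_cost_def sum_list_triv)
qed

lemma (in wf_digraph) graph_dist_ge_2:
  assumes "x \<noteq> y" and "\<not> x \<rightarrow>\<^bsub>G\<^esub> y"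
  shows "2 \<le> graph_dist G x y"
  unfolding graph_dist_def \<mu>_def
proof (rule INF_greatest)
  fix p assume p: "p \<in> {p. awalk x p y}"
  have "length p \<ge> 2"
  proof (rule ccontr)
    assume "\<not> length p \<ge> 2"
    then consider "p = []" | a where "p = [a]"
      by (cases p) (auto simp: not_le less_Suc_eq numeral_2_eq_2)
    then show False
      using p assms by cases
        (auto simp: awalk_Nil_iff awalk_Cons_iff intro: in_arcs_imp_in_arcs_ends)
  qed
  then show "2 \<le> ereal (awalk_cost (\<lambda>_. 1) p)"
    by (simp add: awalk_cost_def sum_list_triv)
qed

text \<open>Distinct vertices are at distance 1 or 2. At distance 2 nothing can be farther away; at
  distance 1 the condition forces each neighbour of \<open>x\<close> to be within distance 1 of
  \<open>y\<close>, a one-sided comparison of closed neighbourhoods.\<close>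

lemma (in wf_digraph) maximally_distant_from_iff_of_diameter_le_2:
  assumes diam: "\<And>a b. a \<in> verts G \<Longrightarrow> b \<in> verts G \<Longrightarrow> graph_dist G a b \<le> 2"
    and xy: "x \<in> verts G" "y \<in> verts G" "x \<noteq> y"
  shows "maximally_distant_from G x y \<longleftrightarrow>
    \<not> x \<rightarrow>\<^bsub>G\<^esub> y \<or> (\<forall>w. x \<rightarrow>\<^bsub>G\<^esub> w \<longrightarrow> w = y \<or> y \<rightarrow>\<^bsub>G\<^esub> w)"
proof (cases "x \<rightarrow>\<^bsub>G\<^esub> y")
  case False
  then have "2 \<le> graph_dist G x y" using xy graph_dist_ge_2 by blast
  then have "graph_dist G y w \<le> graph_dist G x y" if "x \<rightarrow>\<^bsub>G\<^esub> w" for w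
    using diam[OF xy(2), of w] that by (meson adj_in_verts(2) order_trans)
  then show ?thesis using False by (auto simp: maximally_distant_from_def neighbourhood_def)
next
  case True
  then have d: "graph_dist G x y = 1"
    using xy graph_dist_le_1 graph_dist_ge_1 by (meson antisym)
  have "graph_dist G y w \<le> 1 \<longleftrightarrow> w = y \<or> y \<rightarrow>\<^bsub>G\<^esub> w" if "x \<rightarrow>\<^bsub>G\<^esub> w" for w
  proof -
    have "\<not> graph_dist G y w \<le> 1" if "w \<noteq> y" "\<not> y \<rightarrow>\<^bsub>G\<^esub> w"
    proof
      assume "graph_dist G y w \<le> 1"
      with graph_dist_ge_2[of y w] that have "(2::ereal) \<le> 1" by (metis order_trans)
      then show False by simp
    qed
    then show ?thesis
      using graph_dist_le_1[of y w] graph_dist_self[OF xy(2)] by auto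
  qed
  then show ?thesis
    using True d by (auto simp: maximally_distant_from_def neighbourhood_def)
qed

section \<open>Adjacency in the clean graph, idempotents and units\<close>

lemma verts_clean_graph: "verts (clean_graph R) = idempotents R \<times> Units R"
  by (simp add: clean_graph_def)

lemma clean_graph_adj_iff:
  "(e, u) \<rightarrow>\<^bsub>clean_graph R\<^esub> (f, v) \<longleftrightarrow>
    e \<in> idempotents R \<and> u \<in> Units R \<and> f \<in> idempotents R \<and> v \<in> Units R \<and>
    (e, u) \<noteq> (f, v) \<and> (e \<otimes>\<^bsub>R\<^esub> f = \<zero>\<^bsub>R\<^esub> \<or> u \<otimes>\<^bsub>R\<^esub> v = \<one>\<^bsub>R\<^esub>)"
  by (auto simp: clean_graph_def arcs_ends_def arc_to_ends_def)

lemma (in cring) zero_idempotent: "\<zero> \<in> idempotents R"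
  and one_idempotent: "\<one> \<in> idempotents R"
  by (auto simp: idempotents_def)

text \<open>The element is \<open>f\<close> times the complementary idempotent
  \<open>\<one> \<ominus> e\<close>, that is, the part of \<open>f\<close> orthogonal to
  \<open>e\<close>.\<close>

lemma (in cring) idempotent_diff:
  assumes "e \<in> idempotents R" "f \<in> idempotents R"
  shows "f \<ominus> e \<otimes> f \<in> idempotents R"
    and "e \<otimes> (f \<ominus> e \<otimes> f) = \<zero>"
    and "f \<otimes> (f \<ominus> e \<otimes> f) = f \<ominus> e \<otimes> f"
proof -
  have c: "e \<in> carrier R" "f \<in> carrier R" and i: "e \<otimes> e = e" "f \<otimes> f = f"
    using assms by (auto simp: idempotents_def)
  \<comment> \<open>\<open>algebra\<close> uses ring laws only, so squares are collected first and
    then rewritten by \<open>i\<close>.\<close>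
  have "e \<otimes> (f \<ominus> e \<otimes> f) = e \<otimes> f \<ominus> (e \<otimes> e) \<otimes> f" using c by algebra
  also have "\<dots> = \<zero>" unfolding i using c by algebra
  finally show ef: "e \<otimes> (f \<ominus> e \<otimes> f) = \<zero>" .
  have "f \<otimes> (f \<ominus> e \<otimes> f) = f \<otimes> f \<ominus> e \<otimes> (f \<otimes> f)" using c by algebra
  then show ff: "f \<otimes> (f \<ominus> e \<otimes> f) = f \<ominus> e \<otimes> f" using i by simp
  \<comment> \<open>Only the left factor is expanded, so that \<open>ef\<close> and
    \<open>ff\<close> apply.\<close>
  have "(f \<ominus> e \<otimes> f) \<otimes> (f \<ominus> e \<otimes> f)
      = f \<otimes> (f \<ominus> e \<otimes> f) \<ominus> f \<otimes> (e \<otimes> (f \<ominus> e \<otimes> f))" using c by algebra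
  also have "\<dots> = f \<ominus> e \<otimes> f" unfolding ef ff using c by algebra
  finally show "f \<ominus> e \<otimes> f \<in> idempotents R" using c by (simp add: idempotents_def)
qed

text \<open>If \<open>v\<close> is self-inverse, any unit \<open>t\<close> other than
  \<open>v\<close> works, since \<open>v \<otimes> t = \<one> = v \<otimes> v\<close> would cancel
  to \<open>t = v\<close>. The disjunction expresses at least two units, as \<open>card\<close> is 0
  on infinite sets.\<close>

lemma (in cring) ex_unit_neq_self_and_inverse:
  assumes "infinite (Units R) \<or> card (Units R) \<ge> 2" and v: "v \<in> Units R"
  shows "\<exists>t \<in> Units R. t \<noteq> v \<and> v \<otimes> t \<noteq> \<one>"
proof (cases "v \<otimes> v = \<one>")
  case True
  have "\<not> Units R \<subseteq> {v}"
  proof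
    assume s: "Units R \<subseteq> {v}"
    then have "finite (Units R)" "card (Units R) \<le> 1"
      using finite_subset[OF s] card_mono[OF _ s] by auto
    then show False using assms by simp
  qed
  then obtain t where t: "t \<in> Units R" "t \<noteq> v" by auto
  have "v \<otimes> t \<noteq> \<one>"
    using True t v by (metis Units_closed Units_l_cancel)
  then show ?thesis using t by blast
next
  case False
  have "\<one> \<noteq> v" "v \<otimes> \<one> \<noteq> \<one>" using False v by auto
  then show ?thesis by blast
qed

text \<open>Take \<open>\<one>\<close>, or the nontrivial idempotent if \<open>f\<close> itself is
  \<open>\<one>\<close>.\<close>

lemma (in cring) ex_idempotent_neq_overlapping:
  assumes "\<exists>e \<in> idempotents R. e \<noteq> \<zero> \<and> e \<noteq> \<one>" and "f \<in> idempotents R" "f \<noteq> \<zero>"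
  shows "\<exists>g \<in> idempotents R. g \<noteq> f \<and> f \<otimes> g \<noteq> \<zero>"
proof (cases "f = \<one>")
  case True
  then show ?thesis using assms(1) by (auto simp: idempotents_def)
next
  case False
  then show ?thesis using assms one_idempotent by (intro bexI[of _ \<one>]) (auto simp: idempotents_def)
qed

section \<open>Diameter and separating neighbours in the clean graph\<close>

lemma (in cring) clean_graph_dist_le_2:
  assumes "a \<in> verts (clean_graph R)" "b \<in> verts (clean_graph R)"
  shows "graph_dist (clean_graph R) a b \<le> 2"
proof -
  interpret G: sym_digraph "clean_graph R" by (rule clean_graph_simple) unfold_locales
  obtain e u f v where ab: "a = (e, u)" "b = (f, v)" by fastforce
  have m: "e \<in> idempotents R" "u \<in> Units R" "f \<in> idempotents R" "v \<in> Units R"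
    and c: "e \<in> carrier R" "f \<in> carrier R"
    using assms ab by (auto simp: verts_clean_graph idempotents_def)
  consider "a = b" | "a \<rightarrow>\<^bsub>clean_graph R\<^esub> b"
    | "a \<noteq> b" "\<not> a \<rightarrow>\<^bsub>clean_graph R\<^esub> b" by blast
  then show ?thesis
  proof cases
    case 1
    then show ?thesis using G.graph_dist_self[OF assms(1)] by simp
  next
    case 2
    show ?thesis by (rule order_trans[OF G.graph_dist_le_1[OF 2]]) simp
  next
    case 3
    \<comment> \<open>Non-adjacency excludes a zero idempotent part, so
      \<open>(\<zero>, \<one>)\<close> differs from both ends and can serve as the midpoint.\<close>
    then have "e \<noteq> \<zero>" "f \<noteq> \<zero>" using m c ab by (auto simp: clean_graph_adj_iff)
    then have "a \<rightarrow>\<^bsub>clean_graph R\<^esub> (\<zero>, \<one>)" "(\<zero>, \<one>) \<rightarrow>\<^bsub>clean_graph R\<^esub> b"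
      using m c ab zero_idempotent by (auto simp: clean_graph_adj_iff)
    then show ?thesis by (rule G.graph_dist_le_2)
  qed
qed

text \<open>The witness is \<open>(f, t)\<close> with \<open>t\<close> neither \<open>v\<close> nor
  its inverse: it cannot be adjacent to \<open>(f, v)\<close> because
  \<open>f \<otimes> f = f\<close> is nonzero, whereas \<open>(\<zero>, u)\<close> is adjacent to
  every other vertex.\<close>

lemma (in cring) zero_not_maximally_distant:
  assumes "infinite (Units R) \<or> card (Units R) \<ge> 2"
    and "u \<in> Units R" "f \<in> idempotents R" "v \<in> Units R" "f \<noteq> \<zero>"
  shows "\<exists>w. (\<zero>, u) \<rightarrow>\<^bsub>clean_graph R\<^esub> w \<and> w \<noteq> (f, v) \<and> \<not> (f, v) \<rightarrow>\<^bsub>clean_graph R\<^esub> w"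
proof -
  obtain t where "t \<in> Units R" "t \<noteq> v" "v \<otimes> t \<noteq> \<one>"
    using ex_unit_neq_self_and_inverse assms by blast
  then show ?thesis
    using assms zero_idempotent
    by (intro exI[of _ "(f, t)"]) (auto simp: clean_graph_adj_iff idempotents_def)
qed

text \<open>One endpoint has a neighbour outside the closed neighbourhood of the other. Which
  endpoint it is can depend on the order of \<open>e\<close> and \<open>f\<close>: if
  \<open>f\<close> lies below \<open>e\<close>, then \<open>f \<ominus> e \<otimes> f\<close>
  vanishes and the roles are exchanged.\<close>

lemma (in cring) nonzero_adj_not_maximally_distant:
  assumes nontriv: "\<exists>e \<in> idempotents R. e \<noteq> \<zero> \<and> e \<noteq> \<one>"
    and units: "infinite (Units R) \<or> card (Units R) \<ge> 2"
    and adj: "(e, u) \<rightarrow>\<^bsub>clean_graph R\<^esub> (f, v)" and nz: "e \<noteq> \<zero>" "f \<noteq> \<zero>"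
  shows "(\<exists>w. (e, u) \<rightarrow>\<^bsub>clean_graph R\<^esub> w \<and> w \<noteq> (f, v) \<and> \<not> (f, v) \<rightarrow>\<^bsub>clean_graph R\<^esub> w) \<or>
    (\<exists>w. (f, v) \<rightarrow>\<^bsub>clean_graph R\<^esub> w \<and> w \<noteq> (e, u) \<and> \<not> (e, u) \<rightarrow>\<^bsub>clean_graph R\<^esub> w)"
proof -
  have m: "e \<in> idempotents R" "u \<in> Units R" "f \<in> idempotents R" "v \<in> Units R"
    and ne: "(e, u) \<noteq> (f, v)" and or: "e \<otimes> f = \<zero> \<or> u \<otimes> v = \<one>"
    using adj by (auto simp: clean_graph_adj_iff)
  have c: "e \<in> carrier R" "f \<in> carrier R" "u \<in> carrier R" "v \<in> carrier R"
    and i: "e \<otimes> e = e" "f \<otimes> f = f"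
    using m by (auto simp: idempotents_def)
  obtain t where t: "t \<in> Units R" "t \<noteq> v" "v \<otimes> t \<noteq> \<one>"
    using ex_unit_neq_self_and_inverse[OF units m(4)] by blast
  consider "e \<otimes> f = \<zero>" | "u \<otimes> v = \<one>" "v \<otimes> v \<noteq> \<one>" | "u \<otimes> v = \<one>" "v \<otimes> v = \<one>"
    using or by blast
  then show ?thesis
  proof cases
    case 1
    \<comment> \<open>Keeping \<open>f\<close> preserves orthogonality to \<open>e\<close>, and
      \<open>t\<close> breaks the link to \<open>(f, v)\<close>.\<close>
    then have "e \<noteq> f" using i nz by auto
    then show ?thesis
      using 1 m i nz t by (intro disjI1 exI[of _ "(f, t)"]) (auto simp: clean_graph_adj_iff)
  next
    case 2
    \<comment> \<open>Here the unit \<open>v\<close> can be kept: it is inverse to \<open>u\<close>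
      but not to itself, so only the idempotent part has to change.\<close>
    obtain g where g: "g \<in> idempotents R" "g \<noteq> f" "f \<otimes> g \<noteq> \<zero>"
      using ex_idempotent_neq_overlapping[OF nontriv m(3) nz(2)] by blast
    have "u \<noteq> v" using 2 by blast
    then show ?thesis
      using 2 m g by (intro disjI1 exI[of _ "(g, v)"]) (auto simp: clean_graph_adj_iff)
  next
    case 3
    \<comment> \<open>Both \<open>u\<close> and \<open>v\<close> are inverse to
      \<open>v\<close>.\<close>
    have uv: "u = v" using 3 c by (metis m(2,4) Units_l_cancel m_comm)
    then have "e \<noteq> f" using ne by blast
    \<comment> \<open>Orthogonality of \<open>h\<close> to \<open>e'\<close> gives the edge;
      \<open>f' \<otimes> h = h\<close> and the choice of \<open>t\<close> prevent the other one.
      Since \<open>t\<close> differs from \<open>u = v\<close>, the vertex is new.\<close>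
    have key: "(e', u) \<rightarrow>\<^bsub>clean_graph R\<^esub> (h, t) \<and> (h, t) \<noteq> (f', v) \<and>
        \<not> (f', v) \<rightarrow>\<^bsub>clean_graph R\<^esub> (h, t)"
      if "e' \<in> idempotents R" "f' \<in> idempotents R" "h = f' \<ominus> e' \<otimes> f'" "h \<noteq> \<zero>" for e' f' h
      using that idempotent_diff[of e' f'] m t uv by (auto simp: clean_graph_adj_iff)
    \<comment> \<open>If both differences vanished, \<open>e\<close> and \<open>f\<close> would both
      equal their product.\<close>
    have "f \<ominus> e \<otimes> f \<noteq> \<zero> \<or> e \<ominus> f \<otimes> e \<noteq> \<zero>"
    proof (rule ccontr)
      assume "\<not> ?thesis"
      then have "f \<ominus> e \<otimes> f = \<zero>" "e \<ominus> f \<otimes> e = \<zero>" by auto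
      moreover have "f = (f \<ominus> e \<otimes> f) \<oplus> e \<otimes> f" "e = (e \<ominus> f \<otimes> e) \<oplus> f \<otimes> e"
        using c by algebra+
      ultimately have "f = e \<otimes> f" "e = f \<otimes> e"
        using c by (metis l_zero m_closed)+
      then show False using \<open>e \<noteq> f\<close> c m_comm by metis
    qed
    then show ?thesis
    proof
      assume "f \<ominus> e \<otimes> f \<noteq> \<zero>"
      from key[OF m(1,3) refl this] show ?thesis by (intro disjI1 exI)
    next
      assume "e \<ominus> f \<otimes> e \<noteq> \<zero>"
      \<comment> \<open>The endpoints are exchanged in \<open>key\<close>; its units then appear
        swapped, which \<open>uv\<close> repairs.\<close>
      from key[OF m(3,1) refl this] show ?thesis unfolding uv by (intro disjI2 exI)
    qed
  qed
qed

theorem theorem3p3: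
  fixes R :: "('a, 'm) ring_scheme"
  assumes "cring R"
    and "\<exists>e \<in> idempotents R. e \<noteq> \<zero>\<^bsub>R\<^esub> \<and> e \<noteq> \<one>\<^bsub>R\<^esub>"
  shows "(card (Units R) = 1 \<longrightarrow> complete_graph (clean_graph R)) \<and>
    (infinite (Units R) \<or> card (Units R) \<ge> 2 \<longrightarrow>
      (\<forall>e u f v. (e, u) \<in> verts (clean_graph R) \<longrightarrow> (f, v) \<in> verts (clean_graph R) \<longrightarrow>
        (e, u) \<noteq> (f, v) \<longrightarrow>
        (mutually_maximally_distant (clean_graph R) (e, u) (f, v) \<longleftrightarrow>
          (e = \<zero>\<^bsub>R\<^esub> \<and> f = \<zero>\<^bsub>R\<^esub>) \<or>
          (e \<noteq> \<zero>\<^bsub>R\<^esub> \<and> f \<noteq> \<zero>\<^bsub>R\<^esub> \<and> e \<otimes>\<^bsub>R\<^esub> f \<noteq> \<zero>\<^bsub>R\<^esub> \<and> u \<otimes>\<^bsub>R\<^esub> v \<noteq> \<one>\<^bsub>R\<^esub>))))"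
proof (intro conjI impI allI)
  interpret cring R by fact
  assume "card (Units R) = 1"
  then obtain a where "Units R = {a}" by (rule card_1_singletonE)
  \<comment> \<open>The single unit is \<open>\<one>\<close>, so the unit condition for adjacency
    always holds.\<close>
  then have "Units R = {\<one>\<^bsub>R\<^esub>}" using Units_one_closed by auto
  then have "u \<otimes>\<^bsub>R\<^esub> v = \<one>\<^bsub>R\<^esub>" if "u \<in> Units R" "v \<in> Units R" for u v
    using that one_closed by (metis l_one singletonD)
  then have "(e, u) \<rightarrow>\<^bsub>clean_graph R\<^esub> (f, v) \<longleftrightarrow> (e, u) \<in> verts (clean_graph R) \<and>
      (f, v) \<in> verts (clean_graph R) \<and> (e, u) \<noteq> (f, v)" for e u f v
    unfolding clean_graph_adj_iff verts_clean_graph mem_Times_iff fst_conv snd_conv by blast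
  then show "complete_graph (clean_graph R)"
    unfolding complete_graph_def set_eq_iff split_paired_All mem_Collect_eq prod.case by blast
next
  interpret cring R by fact
  interpret G: sym_digraph "clean_graph R" by (rule clean_graph_simple) fact
  fix e u f v
  assume units: "infinite (Units R) \<or> card (Units R) \<ge> 2"
    and x: "(e, u) \<in> verts (clean_graph R)" and y: "(f, v) \<in> verts (clean_graph R)"
    and ne: "(e, u) \<noteq> (f, v)"
  let ?adj = "\<lambda>a b. a \<rightarrow>\<^bsub>clean_graph R\<^esub> b"
  have m: "e \<in> idempotents R" "u \<in> Units R" "f \<in> idempotents R" "v \<in> Units R"
    using x y by (auto simp: verts_clean_graph)
  have sym: "?adj b a" if "?adj a b" for a b using that G.sym_arcs by (simp add: symmetric_def symD)
  \<comment> \<open>By symmetry both directions share the alternative of non-adjacency; what remains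
    is equality of closed neighbourhoods.\<close>
  have mmd: "mutually_maximally_distant (clean_graph R) (e, u) (f, v) \<longleftrightarrow>
      \<not> ?adj (e, u) (f, v) \<or>
      (\<forall>w. ?adj (e, u) w \<longrightarrow> w = (f, v) \<or> ?adj (f, v) w) \<and>
      (\<forall>w. ?adj (f, v) w \<longrightarrow> w = (e, u) \<or> ?adj (e, u) w)"
    unfolding mutually_maximally_distant_def
    using G.maximally_distant_from_iff_of_diameter_le_2[OF clean_graph_dist_le_2 x y ne]
      G.maximally_distant_from_iff_of_diameter_le_2[OF clean_graph_dist_le_2 y x ne[symmetric]]
      sym by blast
  have zero_adj: "?adj (\<zero>\<^bsub>R\<^esub>, s) w"
    if "s \<in> Units R" "w \<in> verts (clean_graph R)" "w \<noteq> (\<zero>\<^bsub>R\<^esub>, s)" for s w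
    using that zero_idempotent
    by (cases w) (auto simp: clean_graph_adj_iff verts_clean_graph idempotents_def)
  show "mutually_maximally_distant (clean_graph R) (e, u) (f, v) \<longleftrightarrow>
      (e = \<zero>\<^bsub>R\<^esub> \<and> f = \<zero>\<^bsub>R\<^esub>) \<or>
      (e \<noteq> \<zero>\<^bsub>R\<^esub> \<and> f \<noteq> \<zero>\<^bsub>R\<^esub> \<and> e \<otimes>\<^bsub>R\<^esub> f \<noteq> \<zero>\<^bsub>R\<^esub> \<and> u \<otimes>\<^bsub>R\<^esub> v \<noteq> \<one>\<^bsub>R\<^esub>)"
  proof -
    \<comment> \<open>Two zero parts give two vertices adjacent to everything else. With exactly one
      zero part the vertices are adjacent but separated, and the right-hand side is false. With
      none, the right-hand side is non-adjacency.\<close>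
    consider "e = \<zero>\<^bsub>R\<^esub>" "f = \<zero>\<^bsub>R\<^esub>" | "e = \<zero>\<^bsub>R\<^esub>" "f \<noteq> \<zero>\<^bsub>R\<^esub>"
      | "e \<noteq> \<zero>\<^bsub>R\<^esub>" "f = \<zero>\<^bsub>R\<^esub>" | "e \<noteq> \<zero>\<^bsub>R\<^esub>" "f \<noteq> \<zero>\<^bsub>R\<^esub>" by blast
    then show ?thesis
    proof cases
      case 1
      then show ?thesis
        unfolding mmd using zero_adj m G.adj_in_verts by blast
    next
      case 2
      then have "?adj (e, u) (f, v)" using zero_adj m y ne by auto
      then show ?thesis
        unfolding mmd using zero_not_maximally_distant[OF units m(2,3,4)] 2 by blast
    next
      case 3
      then have "?adj (e, u) (f, v)" using zero_adj[of v] sym m x ne by auto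
      then show ?thesis
        unfolding mmd using zero_not_maximally_distant[OF units m(4,1,2)] 3 by blast
    next
      case 4
      have "\<not> ?adj (e, u) (f, v) \<longleftrightarrow> e \<otimes>\<^bsub>R\<^esub> f \<noteq> \<zero>\<^bsub>R\<^esub> \<and> u \<otimes>\<^bsub>R\<^esub> v \<noteq> \<one>\<^bsub>R\<^esub>"
        using m ne by (auto simp: clean_graph_adj_iff)
      then show ?thesis
        unfolding mmd using nonzero_adj_not_maximally_distant[OF assms(2) units _ 4] 4 by blast
    qed
  qed
qed

end
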